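(* Let $K$ be a field of characteristic $2$ and let $A$ be an associative commutative $K$-algebra with unit. Then $$\mathrm{H}^2(\mathsf{S}\otimes A,K)\simeq (A/A^{[2]})^*\oplus(A/A^{[2]})^*\oplus\widehat{\mathrm{HC}^1}(A).$$ The basic cocycles can be chosen as follows (the three types realizing the three direct summands): (i) $(f\otimes a)\wedge(f\otimes b)\mapsto \xi(ab)$, where $\xi:A\to K$ is a linear map such that $\xi(A^{[2]})=0$; (ii) $(e\otimes a)\wedge(e\otimes b)\mapsto\xi(ab)$, where $\xi:A\to K$ is a linear map such that $\xi(A^{[2]})=0$; (iii) $(e\otimes a)\wedge(f\otimes b)\mapsto\alpha(a,b)$ and $(h\otimes a)\wedge(h\otimes b)\mapsto\alpha(a,b)$, where $\alpha\in\widehat{\mathrm{HC}^1}(A)$. Here $a,b$ run over $A$.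
   Context: $\mathsf{S}$ is the $3$-dimensional simple Lie algebra over $K$ with basis $\{e,h,f\}$ and multiplication $[e,h]=e$, $[f,h]=f$, $[e,f]=h$. The current Lie algebra $\mathsf{S}\otimes A$ has bracket $[x\otimes a,y\otimes b]=[x,y]\otimes ab$. $\mathrm{H}^2(L,K)$ is the Chevalley--Eilenberg cohomology (with alternating cochains) with coefficients in the trivial module $K$. $A^{[2]}$ is the linear span (a subalgebra) of the squares of all elements of $A$; ${}^*$ denotes the linear dual. $\widehat{\mathrm{HC}^1}(A)$ is the space of bilinear alternating maps $\alpha:A\times A\to K$ (i.e. $\alpha(a,a)=0$) satisfying $\alpha(ab,c)+\alpha(ca,b)+\alpha(bc,a)=0$ for all $a,b,c\in A$. When a cocycle is specified by its values on pairs of basic elements, values on all pairs of types not listed are zero. *)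

theory Defs
  imports
    "HOL-Library.Function_Algebras"
    "HOL-Library.Set_Algebras"
    "HOL-Computational_Algebra.Computational_Algebra"
begin

record ('k, 'v) vspace =
  vcarrier :: "'v set"
  vadd :: "'v \<Rightarrow> 'v \<Rightarrow> 'v"
  vscale :: "'k \<Rightarrow> 'v \<Rightarrow> 'v"

definition linear_iso :: "('v \<Rightarrow> 'w) \<Rightarrow> ('k, 'v) vspace \<Rightarrow> ('k, 'w) vspace \<Rightarrow> bool" where
  "linear_iso \<Phi> V W \<longleftrightarrow>
     bij_betw \<Phi> (vcarrier V) (vcarrier W) \<and>
     (\<forall>x\<in>vcarrier V. \<forall>y\<in>vcarrier V. \<Phi> (vadd V x y) = vadd W (\<Phi> x) (\<Phi> y)) \<and>
     (\<forall>c. \<forall>x\<in>vcarrier V. \<Phi> (vscale V c x) = vscale W c (\<Phi> x))"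

definition isomorphic :: "('k, 'v) vspace \<Rightarrow> ('k, 'w) vspace \<Rightarrow> bool" (infix \<open>\<simeq>\<close> 50) where
  "V \<simeq> W \<longleftrightarrow> (\<exists>\<Phi>. linear_iso \<Phi> V W)"

definition subspace_vs :: "('k \<Rightarrow> 'v \<Rightarrow> 'v) \<Rightarrow> 'v set \<Rightarrow> ('k, 'v::ab_group_add) vspace" where
  "subspace_vs s V = \<lparr>vcarrier = V, vadd = (+), vscale = s\<rparr>"

text \<open>
  The quotient \<open>V / U\<close> consists of the cosets \<open>x + U\<close> with \<open>x \<in> V\<close>. The sum of two cosets is
  their elementwise sum; adding \<open>U\<close> after scaling matters only for the scalar \<open>0\<close>.
\<close>

definition quotient_vs ::
    "('k \<Rightarrow> 'v \<Rightarrow> 'v) \<Rightarrow> 'v set \<Rightarrow> 'v set \<Rightarrow> ('k, 'v::ab_group_add set) vspace" where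
  "quotient_vs s V U =
     \<lparr>vcarrier = (\<lambda>x. x +o U) ` V, vadd = (+), vscale = (\<lambda>c X. s c ` X + U)\<rparr>"

text \<open>
  Functionals on \<open>V\<close> are represented by functions that vanish outside the carrier of \<open>V\<close>.
\<close>

definition dual_vs :: "('k::field, 'v) vspace \<Rightarrow> ('k, 'v \<Rightarrow> 'k) vspace" where
  "dual_vs V =
     \<lparr>vcarrier = {\<phi>. (\<forall>x\<in>vcarrier V. \<forall>y\<in>vcarrier V. \<phi> (vadd V x y) = \<phi> x + \<phi> y) \<and>
                    (\<forall>c. \<forall>x\<in>vcarrier V. \<phi> (vscale V c x) = c * \<phi> x) \<and>
                    (\<forall>x. x \<notin> vcarrier V \<longrightarrow> \<phi> x = 0)},
      vadd = (\<lambda>\<phi> \<psi> x. \<phi> x + \<psi> x),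
      vscale = (\<lambda>c \<phi> x. c * \<phi> x)\<rparr>"

definition direct_sum ::
    "('k, 'v) vspace \<Rightarrow> ('k, 'w) vspace \<Rightarrow> ('k, 'v \<times> 'w) vspace" (infixr \<open>\<oplus>\<close> 65) where
  "V \<oplus> W =
     \<lparr>vcarrier = vcarrier V \<times> vcarrier W,
      vadd = (\<lambda>(v, w) (v', w'). (vadd V v v', vadd W w w')),
      vscale = (\<lambda>c (v, w). (vscale V c v, vscale W c w))\<rparr>"

definition alternating_bilinear ::
    "('k::field \<Rightarrow> 'l::ab_group_add \<Rightarrow> 'l) \<Rightarrow> ('l \<Rightarrow> 'l \<Rightarrow> 'k) \<Rightarrow> bool" where
  "alternating_bilinear s \<omega> \<longleftrightarrow>
     (\<forall>x. Vector_Spaces.linear s (*) (\<lambda>y. \<omega> x y)) \<and>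
     (\<forall>y. Vector_Spaces.linear s (*) (\<lambda>x. \<omega> x y)) \<and>
     (\<forall>x. \<omega> x x = 0)"

locale lie_algebra = vector_space s
  for s :: "'k::field \<Rightarrow> 'l::ab_group_add \<Rightarrow> 'l" +
  fixes br :: "'l \<Rightarrow> 'l \<Rightarrow> 'l"
  assumes linear_right: "Vector_Spaces.linear s s (\<lambda>y. br x y)"
    and linear_left: "Vector_Spaces.linear s s (\<lambda>x. br x y)"
    and alternating: "br x x = 0"
    and jacobi: "br (br x y) z + br (br y z) x + br (br z x) y = 0"

text \<open>
  The Chevalley--Eilenberg differentials
  \<open>(d \<omega>)(x\<^sub>1, \<dots>) = \<Sum>i<j. (-1)^(i+j) \<omega>([x\<^sub>i, x\<^sub>j], \<dots>)\<close> in degrees 1 and 2.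
\<close>

definition ce_d1 :: "('l \<Rightarrow> 'l \<Rightarrow> 'l) \<Rightarrow> ('l \<Rightarrow> 'k::field) \<Rightarrow> 'l \<Rightarrow> 'l \<Rightarrow> 'k" where
  "ce_d1 br \<eta> = (\<lambda>x y. - \<eta> (br x y))"

definition ce_d2 ::
    "('l \<Rightarrow> 'l \<Rightarrow> 'l) \<Rightarrow> ('l \<Rightarrow> 'l \<Rightarrow> 'k::field) \<Rightarrow> 'l \<Rightarrow> 'l \<Rightarrow> 'l \<Rightarrow> 'k" where
  "ce_d2 br \<omega> = (\<lambda>x y z. - \<omega> (br x y) z + \<omega> (br x z) y - \<omega> (br y z) x)"

definition ce_Z2 ::
    "('k::field \<Rightarrow> 'l::ab_group_add \<Rightarrow> 'l) \<Rightarrow> ('l \<Rightarrow> 'l \<Rightarrow> 'l) \<Rightarrow> ('l \<Rightarrow> 'l \<Rightarrow> 'k) set" where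
  "ce_Z2 s br = {\<omega>. alternating_bilinear s \<omega> \<and> ce_d2 br \<omega> = (\<lambda>x y z. 0)}"

definition ce_B2 ::
    "('k::field \<Rightarrow> 'l::ab_group_add \<Rightarrow> 'l) \<Rightarrow> ('l \<Rightarrow> 'l \<Rightarrow> 'l) \<Rightarrow> ('l \<Rightarrow> 'l \<Rightarrow> 'k) set" where
  "ce_B2 s br = ce_d1 br ` {\<eta>. Vector_Spaces.linear s (*) \<eta>}"

definition scale2 :: "'k::field \<Rightarrow> ('l \<Rightarrow> 'l \<Rightarrow> 'k) \<Rightarrow> 'l \<Rightarrow> 'l \<Rightarrow> 'k" where
  "scale2 c \<omega> = (\<lambda>x y. c * \<omega> x y)"

definition ce_H2 ::
    "('k::field \<Rightarrow> 'l::ab_group_add \<Rightarrow> 'l) \<Rightarrow> ('l \<Rightarrow> 'l \<Rightarrow> 'l) \<Rightarrow> ('k, ('l \<Rightarrow> 'l \<Rightarrow> 'k) set) vspace"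
  where "ce_H2 s br = quotient_vs scale2 (ce_Z2 s br) (ce_B2 s br)"

definition cohomology_class ::
    "('k::field \<Rightarrow> 'l::ab_group_add \<Rightarrow> 'l) \<Rightarrow> ('l \<Rightarrow> 'l \<Rightarrow> 'l) \<Rightarrow> ('l \<Rightarrow> 'l \<Rightarrow> 'k) \<Rightarrow> ('l \<Rightarrow> 'l \<Rightarrow> 'k) set"
  where "cohomology_class s br \<omega> = \<omega> +o ce_B2 s br"

text \<open>
  The sort \<open>{comm_ring, comm_monoid_mult}\<close> describes commutative rings with unit in which
  \<open>1 = 0\<close> is not excluded, unlike in \<open>comm_ring_1\<close>.
\<close>

locale comm_unital_algebra = vector_space scale
  for scale :: "'k::field \<Rightarrow> 'a::{comm_ring, comm_monoid_mult} \<Rightarrow> 'a" +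
  assumes scale_mult_left: "scale c a * b = scale c (a * b)"
begin

lemma scale_mult_right: "a * scale c b = scale c (a * b)"
  using scale_mult_left[of c b a] by (simp add: mult.commute)

end

text \<open>The span \<open>A\<^sup>[\<^sup>2\<^sup>]\<close> of the squares.\<close>

definition squares_span ::
    "('k::field \<Rightarrow> 'a::{comm_ring, comm_monoid_mult} \<Rightarrow> 'a) \<Rightarrow> 'a set" where
  "squares_span scale = module.span scale (range (\<lambda>a. a ^ 2))"

definition HC1_hat ::
    "('k::field \<Rightarrow> 'a::{comm_ring, comm_monoid_mult} \<Rightarrow> 'a) \<Rightarrow> ('a \<Rightarrow> 'a \<Rightarrow> 'k) set" where
  "HC1_hat scale =
     {\<alpha>. alternating_bilinear scale \<alpha> \<and>
          (\<forall>a b c. \<alpha> (a * b) c + \<alpha> (c * a) b + \<alpha> (b * c) a = 0)}"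

datatype sbasis = E | H | F

lemma UNIV_sbasis: "UNIV = {E, H, F}"
  by (auto intro: sbasis.exhaust)

instance sbasis :: finite
  by standard (simp add: UNIV_sbasis)

text \<open>Elements of \<open>S\<close> are coordinate functions \<open>sbasis \<Rightarrow> 'k\<close>.\<close>

definition sb :: "sbasis \<Rightarrow> sbasis \<Rightarrow> 'k::field" where
  "sb i = (\<lambda>j. if j = i then 1 else 0)"

fun basis_bracket :: "sbasis \<Rightarrow> sbasis \<Rightarrow> sbasis \<Rightarrow> 'k::field" where
  "basis_bracket E H = sb E"
| "basis_bracket H E = - sb E"
| "basis_bracket F H = sb F"
| "basis_bracket H F = - sb F"
| "basis_bracket E F = sb H"
| "basis_bracket F E = - sb H"
| "basis_bracket E E = 0"
| "basis_bracket H H = 0"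
| "basis_bracket F F = 0"

definition S_scale :: "'k::field \<Rightarrow> (sbasis \<Rightarrow> 'k) \<Rightarrow> sbasis \<Rightarrow> 'k" where
  "S_scale c x = (\<lambda>i. c * x i)"

definition S_bracket :: "(sbasis \<Rightarrow> 'k::field) \<Rightarrow> (sbasis \<Rightarrow> 'k) \<Rightarrow> sbasis \<Rightarrow> 'k" where
  "S_bracket x y = (\<Sum>i\<in>UNIV. \<Sum>j\<in>UNIV. S_scale (x i * y j) (basis_bracket i j))"

text \<open>
  Since \<open>S\<close> has basis \<open>{E, H, F}\<close>, the space \<open>S \<otimes> A\<close> is modelled by the functions
  \<open>sbasis \<Rightarrow> 'a\<close>: the function \<open>u\<close> stands for \<open>\<Sum>i. i \<otimes> u i\<close>. Lemma \<open>tensor_universal\<close> below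
  is the universal property of the tensor product.
\<close>

definition current_scale ::
    "('k::field \<Rightarrow> 'a::ab_group_add \<Rightarrow> 'a) \<Rightarrow> 'k \<Rightarrow> (sbasis \<Rightarrow> 'a) \<Rightarrow> sbasis \<Rightarrow> 'a" where
  "current_scale scale c u = (\<lambda>i. scale c (u i))"

definition tensor ::
    "('k::field \<Rightarrow> 'a::ab_group_add \<Rightarrow> 'a) \<Rightarrow> (sbasis \<Rightarrow> 'k) \<Rightarrow> 'a \<Rightarrow> sbasis \<Rightarrow> 'a" where
  "tensor scale x a = (\<lambda>i. scale (x i) a)"

definition current_bracket ::
    "('k::field \<Rightarrow> 'a::{comm_ring, comm_monoid_mult} \<Rightarrow> 'a) \<Rightarrow>
     (sbasis \<Rightarrow> 'a) \<Rightarrow> (sbasis \<Rightarrow> 'a) \<Rightarrow> sbasis \<Rightarrow> 'a" where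
  "current_bracket scale u v =
     (\<Sum>i\<in>UNIV. \<Sum>j\<in>UNIV. tensor scale (basis_bracket i j) (u i * v j))"

lemma sum_fun_apply: "sum f I x = (\<Sum>i\<in>I. f i x)"
  for f :: "'i \<Rightarrow> 'x \<Rightarrow> 'y::comm_monoid_add"
  by (induction I rule: infinite_finite_induct) auto

lemma sum_sbasis: "sum f UNIV = f E + f H + f F"
  for f :: "sbasis \<Rightarrow> 'y::comm_monoid_add"
  by (simp add: UNIV_sbasis add.assoc)

lemma S_bracket_basis: "S_bracket (sb i) (sb j) = basis_bracket i j"
  by (cases i; cases j)
    (auto simp: S_bracket_def S_scale_def sum_sbasis sb_def fun_eq_iff)

context comm_unital_algebra
begin

lemma vector_space_current: "vector_space (current_scale scale)"
  by unfold_locales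
    (auto simp: current_scale_def fun_eq_iff scale_right_distrib scale_left_distrib)

lemma tensor_bilinear:
  "Vector_Spaces.linear scale (current_scale scale) (\<lambda>a. tensor scale x a)"
  "Vector_Spaces.linear S_scale (current_scale scale) (\<lambda>x. tensor scale x a)"
proof -
  interpret L: vector_space "current_scale scale" by (rule vector_space_current)
  show "Vector_Spaces.linear scale (current_scale scale) (\<lambda>a. tensor scale x a)"
    by unfold_locales
      (auto simp: current_scale_def tensor_def fun_eq_iff scale_right_distrib mult.commute)
  show "Vector_Spaces.linear S_scale (current_scale scale) (\<lambda>x. tensor scale x a)"
    by unfold_locales
      (auto simp: S_scale_def current_scale_def tensor_def fun_eq_iff scale_left_distrib algebra_simps)
qed

lemma current_eq_sum_tensor: "u = (\<Sum>i\<in>UNIV. tensor scale (sb i) (u i))"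
proof
  fix k show "u k = (\<Sum>i\<in>UNIV. tensor scale (sb i) (u i)) k"
    by (cases k) (simp_all add: sum_sbasis tensor_def sb_def)
qed

lemma tensor_universal:
  fixes s :: "'k \<Rightarrow> 'w::ab_group_add \<Rightarrow> 'w" and \<beta> :: "(sbasis \<Rightarrow> 'k) \<Rightarrow> 'a \<Rightarrow> 'w"
  assumes linA: "\<And>x. Vector_Spaces.linear scale s (\<lambda>a. \<beta> x a)"
    and linS: "\<And>a. Vector_Spaces.linear S_scale s (\<lambda>x. \<beta> x a)"
  shows "\<exists>!g. Vector_Spaces.linear (current_scale scale) s g \<and>
              (\<forall>x a. g (tensor scale x a) = \<beta> x a)"
proof (rule ex1I)
  interpret L: vector_space "current_scale scale" by (rule vector_space_current)
  interpret A: Vector_Spaces.linear scale s "\<lambda>a. \<beta> x a" for x by (rule linA)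
  interpret S: Vector_Spaces.linear S_scale s "\<lambda>x. \<beta> x a" for a by (rule linS)
  let ?g = "\<lambda>u. \<Sum>i\<in>UNIV. \<beta> (sb i) (u i)"
  have "Vector_Spaces.linear (current_scale scale) s ?g"
    by unfold_locales
      (simp_all add: current_scale_def A.add A.scale sum.distrib A.vs2.scale_sum_right)
  moreover have "?g (tensor scale x a) = \<beta> x a" for x a
  proof -
    have x: "x = (\<Sum>i\<in>UNIV. S_scale (x i) (sb i))"
    proof
      fix k show "x k = (\<Sum>i\<in>UNIV. S_scale (x i) (sb i)) k"
        by (cases k) (simp_all add: sum_sbasis S_scale_def sb_def)
    qed
    have "?g (tensor scale x a) = (\<Sum>i\<in>UNIV. s (x i) (\<beta> (sb i) a))"
      by (simp add: tensor_def A.scale)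
    also have "\<dots> = \<beta> (\<Sum>i\<in>UNIV. S_scale (x i) (sb i)) a"
      by (simp add: S.sum S.scale)
    finally show ?thesis using x by simp
  qed
  ultimately show "Vector_Spaces.linear (current_scale scale) s ?g \<and>
                   (\<forall>x a. ?g (tensor scale x a) = \<beta> x a)" by blast
  fix g assume g: "Vector_Spaces.linear (current_scale scale) s g \<and>
                   (\<forall>x a. g (tensor scale x a) = \<beta> x a)"
  then interpret g: Vector_Spaces.linear "current_scale scale" s g by simp
  show "g = ?g"
  proof
    fix u
    have "g u = g (\<Sum>i\<in>UNIV. tensor scale (sb i) (u i))"
      using current_eq_sum_tensor[of u] by simp
    also have "\<dots> = ?g u" using g by (simp add: g.sum)
    finally show "g u = ?g u" .
  qed
qed

lemma current_bracket_eqs: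
  "current_bracket scale u v E = u E * v H - u H * v E"
  "current_bracket scale u v F = u F * v H - u H * v F"
  "current_bracket scale u v H = u E * v F - u F * v E"
  by (simp_all add: current_bracket_def sum_sbasis tensor_def sb_def)

lemma current_bracket_tensor:
  "current_bracket scale (tensor scale x a) (tensor scale y b) =
     tensor scale (S_bracket x y) (a * b)"
proof
  fix k show "current_bracket scale (tensor scale x a) (tensor scale y b) k =
     tensor scale (S_bracket x y) (a * b) k"
    by (cases k)
      (simp_all add: current_bracket_eqs tensor_def S_bracket_def S_scale_def sum_sbasis sb_def
        scale_mult_left scale_mult_right scale_left_diff_distrib mult.commute)
qed

lemma current_lie_algebra:
  assumes "CHAR('k) = 2"
  shows "lie_algebra (current_scale scale) (current_bracket scale)"
proof -
  interpret L: vector_space "current_scale scale" by (rule vector_space_current)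
  have two: "a + a = 0" for a :: 'a
  proof -
    have "(1::'k) + 1 = 0" using of_nat_CHAR[where 'a = 'k] by (simp add: assms)
    then have "scale (1 + 1) a = 0" by simp
    then show ?thesis unfolding scale_left_distrib by simp
  qed
  then have neg: "- a = a" for a :: 'a by (simp add: minus_unique)
  have dif: "a - b = a + b" for a b :: 'a
    by (metis neg diff_conv_add_uminus)
  have two': "a + (a + b) = b" for a b :: 'a by (simp add: two flip: add.assoc)
  show ?thesis
  proof (unfold_locales, goal_cases)
    case (5 x)
    show ?case
    proof
      fix k show "current_bracket scale x x k = 0 k"
        by (cases k) (simp_all add: current_bracket_eqs mult.commute)
    qed
  next
    case (6 x y z)
    show ?case
    proof
      fix k
      show "(current_bracket scale (current_bracket scale x y) z +
             current_bracket scale (current_bracket scale y z) x +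
             current_bracket scale (current_bracket scale z x) y) k = 0 k"
        by (cases k) (simp_all add: current_bracket_eqs dif distrib_left distrib_right
            ac_simps two two')
    qed
  next
    case (1 x a b)
    show ?case
    proof
      fix k show "current_bracket scale x (a + b) k =
        (current_bracket scale x a + current_bracket scale x b) k"
        by (cases k) (simp_all add: current_bracket_eqs algebra_simps)
    qed
  next
    case (2 x c b)
    show ?case
    proof
      fix k show "current_bracket scale x (current_scale scale c b) k =
        current_scale scale c (current_bracket scale x b) k"
        by (cases k) (simp_all add: current_bracket_eqs current_scale_def scale_mult_right
            scale_mult_left scale_right_diff_distrib)
    qed
  next
    case (3 x a b)
    show ?case
    proof
      fix k show "current_bracket scale (a + b) x k =
        (current_bracket scale a x + current_bracket scale b x) k"
        by (cases k) (simp_all add: current_bracket_eqs algebra_simps)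
    qed
  next
    case (4 x c b)
    show ?case
    proof
      fix k show "current_bracket scale (current_scale scale c b) x k =
        current_scale scale c (current_bracket scale b x) k"
        by (cases k) (simp_all add: current_bracket_eqs current_scale_def scale_mult_right
            scale_mult_left scale_right_diff_distrib)
    qed
  qed
qed

end

text \<open>
  Pulling back along \<open>a \<mapsto> a + A\<^sup>[\<^sup>2\<^sup>]\<close> identifies \<open>(A / A\<^sup>[\<^sup>2\<^sup>])\<^sup>*\<close> with the linear maps on \<open>A\<close> that vanish
  on \<open>A\<^sup>[\<^sup>2\<^sup>]\<close>.
\<close>

lemma (in comm_unital_algebra) dual_quotient_pullback:
  defines "A2 \<equiv> squares_span scale"
  shows "bij_betw (\<lambda>\<phi> a. \<phi> (a +o A2)) (vcarrier (dual_vs (quotient_vs scale UNIV A2)))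
           {\<xi>. Vector_Spaces.linear scale (*) \<xi> \<and> (\<forall>a\<in>A2. \<xi> a = 0)}"
proof -
  let ?D = "vcarrier (dual_vs (quotient_vs scale UNIV A2))"
  let ?X = "{\<xi>. Vector_Spaces.linear scale (*) \<xi> \<and> (\<forall>a\<in>A2. \<xi> a = 0)}"
  let ?P = "\<lambda>\<phi> a. \<phi> (a +o A2)"
  have A2: "subspace A2" unfolding A2_def squares_span_def by (rule subspace_span)
  have K: "vector_space ((*) :: 'k \<Rightarrow> 'k \<Rightarrow> 'k)"
    by unfold_locales (simp_all add: algebra_simps)
  have zero: "0 \<in> A2" using A2 by (rule subspace_0)
  have coset_add: "(a +o A2) + (b +o A2) = (a + b) +o A2" for a b
  proof (intro set_eqI iffI)
    fix x assume "x \<in> (a +o A2) + (b +o A2)"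
    then obtain u v where "u \<in> A2" "v \<in> A2" "x = (a + u) + (b + v)"
      by (auto simp: set_plus_def elt_set_plus_def)
    then have "u + v \<in> A2" "x = (a + b) + (u + v)"
      using subspace_add[OF A2] by (auto simp: algebra_simps)
    then show "x \<in> (a + b) +o A2" by (auto simp: elt_set_plus_def)
  next
    fix x assume "x \<in> (a + b) +o A2"
    then obtain u where "u \<in> A2" "x = (a + u) + (b + 0)"
      by (auto simp: elt_set_plus_def algebra_simps)
    then show "x \<in> (a +o A2) + (b +o A2)"
      using zero by (auto simp: set_plus_def elt_set_plus_def)
  qed
  have coset_scale: "scale c ` (a +o A2) + A2 = scale c a +o A2" for c a
  proof (intro set_eqI iffI)
    fix x assume "x \<in> scale c ` (a +o A2) + A2"
    then obtain u v where "u \<in> A2" "v \<in> A2" "x = scale c (a + u) + v"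
      by (auto simp: set_plus_def elt_set_plus_def)
    then have "scale c u + v \<in> A2" "x = scale c a + (scale c u + v)"
      using subspace_add[OF A2] subspace_scale[OF A2] by (auto simp: scale_right_distrib add.assoc)
    then show "x \<in> scale c a +o A2" by (auto simp: elt_set_plus_def)
  next
    fix x assume "x \<in> scale c a +o A2"
    then obtain v where "v \<in> A2" "x = scale c (a + 0) + v"
      by (auto simp: elt_set_plus_def)
    then show "x \<in> scale c ` (a +o A2) + A2"
      using zero unfolding set_plus_def elt_set_plus_def by blast
  qed
  have D: "\<phi> \<in> ?D \<longleftrightarrow> (\<forall>a b. \<phi> ((a + b) +o A2) = \<phi> (a +o A2) + \<phi> (b +o A2)) \<and>
             (\<forall>c a. \<phi> (scale c a +o A2) = c * \<phi> (a +o A2)) \<and>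
             (\<forall>X. X \<notin> range (\<lambda>a. a +o A2) \<longrightarrow> \<phi> X = 0)" for \<phi>
    by (simp add: dual_vs_def quotient_vs_def coset_add coset_scale)
  have coset_A2: "a +o A2 = A2" if "a \<in> A2" for a
  proof (intro set_eqI iffI)
    fix x assume "x \<in> a +o A2"
    then show "x \<in> A2" using subspace_add[OF A2] that by (auto simp: elt_set_plus_def)
  next
    fix x assume "x \<in> A2"
    then have "x - a \<in> A2" "x = a + (x - a)" using subspace_diff[OF A2] that by auto
    then show "x \<in> a +o A2" unfolding elt_set_plus_def by blast
  qed
  show ?thesis
  proof (rule bij_betw_imageI)
    show "inj_on ?P ?D"
    proof (rule inj_onI)
      fix \<phi> \<psi> assume D': "\<phi> \<in> ?D" "\<psi> \<in> ?D" and eq: "?P \<phi> = ?P \<psi>"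
      show "\<phi> = \<psi>"
      proof
        fix X
        show "\<phi> X = \<psi> X"
        proof (cases "X \<in> range (\<lambda>a. a +o A2)")
          case True
          then obtain a where "X = a +o A2" by blast
          then show ?thesis using fun_cong[OF eq, of a] by simp
        next
          case False
          then show ?thesis using D' D by metis
        qed
      qed
    qed
    show "?P ` ?D = ?X"
    proof (intro set_eqI iffI)
      fix \<xi> assume "\<xi> \<in> ?P ` ?D"
      then obtain \<phi> where \<phi>: "\<phi> \<in> ?D" "\<xi> = ?P \<phi>" by blast
      interpret K: vector_space "(*) :: 'k \<Rightarrow> 'k \<Rightarrow> 'k" by (rule K)
      have "Vector_Spaces.linear scale (*) \<xi>"
        by unfold_locales (use \<phi> D in auto)
      moreover have "\<xi> a = 0" if "a \<in> A2" for a
      proof -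
        have "\<phi> (scale 0 0 +o A2) = 0 * \<phi> (0 +o A2)" using \<phi>(1) D by blast
        then show ?thesis using \<phi>(2) coset_A2[OF that] coset_A2[OF zero] by simp
      qed
      ultimately show "\<xi> \<in> ?X" by blast
    next
      fix \<xi> assume \<xi>: "\<xi> \<in> ?X"
      then interpret \<xi>: Vector_Spaces.linear scale "(*)" \<xi> by simp
      define \<phi> where "\<phi> X = (if X \<in> range (\<lambda>a. a +o A2) then \<xi> (SOME a. a \<in> X) else 0)" for X
      have \<phi>: "\<phi> (a +o A2) = \<xi> a" for a
      proof -
        have "a \<in> a +o A2" using zero by (force simp: elt_set_plus_def)
        then have "(SOME b. b \<in> a +o A2) \<in> a +o A2" by (rule someI)
        then obtain u where "u \<in> A2" "(SOME b. b \<in> a +o A2) = a + u"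
          by (auto simp: elt_set_plus_def)
        then show ?thesis using \<xi> by (auto simp: \<phi>_def \<xi>.add)
      qed
      have "\<phi> \<in> ?D" unfolding D \<phi> by (auto simp: \<xi>.add \<xi>.scale \<phi>_def)
      moreover have "\<xi> = ?P \<phi>" by (simp add: \<phi>)
      ultimately show "\<xi> \<in> ?P ` ?D" by blast
    qed
  qed
qed

text \<open>
  The bilinear map with \<open>(i \<otimes> a, j \<otimes> b) \<mapsto> p i j a b\<close> on basis elements \<open>i\<close>, \<open>j\<close> of \<open>S\<close>.
\<close>

definition cochain_of ::
    "(sbasis \<Rightarrow> sbasis \<Rightarrow> 'a \<Rightarrow> 'a \<Rightarrow> 'k::field) \<Rightarrow> (sbasis \<Rightarrow> 'a) \<Rightarrow> (sbasis \<Rightarrow> 'a) \<Rightarrow> 'k" where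
  "cochain_of p u v = (\<Sum>i\<in>UNIV. \<Sum>j\<in>UNIV. p i j (u i) (v j))"

fun values_ff :: "('a::times \<Rightarrow> 'k::field) \<Rightarrow> sbasis \<Rightarrow> sbasis \<Rightarrow> 'a \<Rightarrow> 'a \<Rightarrow> 'k" where
  "values_ff \<xi> F F = (\<lambda>a b. \<xi> (a * b))"
| "values_ff \<xi> _ _ = (\<lambda>a b. 0)"

fun values_ee :: "('a::times \<Rightarrow> 'k::field) \<Rightarrow> sbasis \<Rightarrow> sbasis \<Rightarrow> 'a \<Rightarrow> 'a \<Rightarrow> 'k" where
  "values_ee \<xi> E E = (\<lambda>a b. \<xi> (a * b))"
| "values_ee \<xi> _ _ = (\<lambda>a b. 0)"

text \<open>
  The value on \<open>(f \<otimes> a) \<and> (e \<otimes> b)\<close> is forced by alternation.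
\<close>

fun values_ef_hh :: "('a \<Rightarrow> 'a \<Rightarrow> 'k::field) \<Rightarrow> sbasis \<Rightarrow> sbasis \<Rightarrow> 'a \<Rightarrow> 'a \<Rightarrow> 'k" where
  "values_ef_hh \<alpha> E F = (\<lambda>a b. \<alpha> a b)"
| "values_ef_hh \<alpha> F E = (\<lambda>a b. - \<alpha> b a)"
| "values_ef_hh \<alpha> H H = (\<lambda>a b. \<alpha> a b)"
| "values_ef_hh \<alpha> _ _ = (\<lambda>a b. 0)"

definition cocycle_ff :: "('a::times \<Rightarrow> 'k::field) \<Rightarrow> (sbasis \<Rightarrow> 'a) \<Rightarrow> (sbasis \<Rightarrow> 'a) \<Rightarrow> 'k" where
  "cocycle_ff \<xi> = cochain_of (values_ff \<xi>)"

definition cocycle_ee :: "('a::times \<Rightarrow> 'k::field) \<Rightarrow> (sbasis \<Rightarrow> 'a) \<Rightarrow> (sbasis \<Rightarrow> 'a) \<Rightarrow> 'k" where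
  "cocycle_ee \<xi> = cochain_of (values_ee \<xi>)"

definition cocycle_ef_hh :: "('a \<Rightarrow> 'a \<Rightarrow> 'k::field) \<Rightarrow> (sbasis \<Rightarrow> 'a) \<Rightarrow> (sbasis \<Rightarrow> 'a) \<Rightarrow> 'k" where
  "cocycle_ef_hh \<alpha> = cochain_of (values_ef_hh \<alpha>)"

lemma (in comm_unital_algebra) cochain_of_tensor:
  assumes "\<And>i j a. p i j 0 a = 0" "\<And>i j a. p i j a 0 = 0"
  shows "cochain_of p (tensor scale (sb i) a) (tensor scale (sb j) b) = p i j a b"
  by (cases i; cases j) (simp_all add: cochain_of_def sum_sbasis tensor_def sb_def assms)

end

theory Submission
  imports Defs
begin

text \<open>
  Write \<open>ij(a, b)\<close> for the value \<open>\<omega>(i \<otimes> a, j \<otimes> b)\<close> of an alternating form \<open>\<omega>\<close> on \<open>S \<otimes> A\<close>, where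
  \<open>i\<close> and \<open>j\<close> run over the basis \<open>e, h, f\<close> of \<open>S\<close>. In characteristic 2 signs disappear and \<open>\<omega>\<close> is
  symmetric. The cocycle identity is needed on the following kinds of triples, and putting the unit
  of \<open>A\<close> into one slot solves each of them:

  \<^item> \<open>e, h, h\<close> gives \<open>eh(ab, c) = eh(ac, b)\<close>, so \<open>eh(a, b) = eh(ab, 1)\<close> depends on the product only;
    likewise for \<open>fh\<close>.
  \<^item> \<open>e, e, h\<close> gives \<open>ee(bc, a) = ee(ac, b)\<close>, so \<open>ee(a, b) = \<xi>(ab)\<close> with \<open>\<xi> = ee(-, 1)\<close>. Since \<open>\<omega>\<close> is
    alternating, \<open>\<xi>(a\<^sup>2) = 0\<close>, that is, \<open>\<xi>\<close> vanishes on \<open>A\<^sup>[\<^sup>2\<^sup>]\<close>; likewise for \<open>ff\<close>.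
  \<^item> \<open>e, f, h\<close> gives \<open>hh(ab, c) + ef(ac, b) + ef(a, bc) = 0\<close>. For \<open>a = 1\<close> this says
    \<open>ef(c, b) = hh(c, b) + ef(1, bc)\<close>, and inserting this into the general identity cancels the two
    occurrences of \<open>ef(1, abc)\<close> and leaves the cyclic identity for \<open>\<alpha> = hh\<close>.

  Coboundaries \<open>\<eta>([-, -])\<close> are exactly the forms whose \<open>eh\<close>, \<open>fh\<close> and \<open>ef\<close> components are three
  arbitrary functionals of the product \<open>ab\<close> and whose other components vanish. So the functionals
  \<open>eh(-, 1)\<close>, \<open>fh(-, 1)\<close> and \<open>ef(1, -)\<close> can be removed by a coboundary, and what remains of \<open>\<omega>\<close> is a
  sum of one cocycle of each of the three types (\<open>cocycle_normal_form\<close>). The summands are determined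
  by the class of \<open>\<omega>\<close>, because they can be read off from \<open>ff\<close>, \<open>ee\<close> and \<open>hh\<close>, where coboundaries
  vanish (\<open>normal_form_unique\<close>). The isomorphism is then assembled in \<open>second_cohomology\<close>.
\<close>

section \<open>Isomorphisms onto a quotient\<close>

text \<open>
  The closure hypotheses on \<open>V\<close> are what makes the inverse additive and homogeneous: linearity of
  \<open>\<Phi>\<close> identifies only the images, and injectivity of \<open>\<Phi>\<close> applies only inside the carrier.
\<close>

lemma linear_iso_inverse:
  assumes iso: "linear_iso \<Phi> V W"
    and add: "\<And>x y. x \<in> vcarrier V \<Longrightarrow> y \<in> vcarrier V \<Longrightarrow> vadd V x y \<in> vcarrier V"
    and scale: "\<And>c x. x \<in> vcarrier V \<Longrightarrow> vscale V c x \<in> vcarrier V"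
  shows "linear_iso (inv_into (vcarrier V) \<Phi>) W V"
proof -
  let ?\<Psi> = "inv_into (vcarrier V) \<Phi>"
  have bij: "bij_betw \<Phi> (vcarrier V) (vcarrier W)" using iso by (simp add: linear_iso_def)
  have mem: "?\<Psi> y \<in> vcarrier V" and right: "\<Phi> (?\<Psi> y) = y" if "y \<in> vcarrier W" for y
    using bij that by (auto simp: bij_betw_def inv_into_into f_inv_into_f)
  have left: "?\<Psi> (\<Phi> x) = x" if "x \<in> vcarrier V" for x
    using bij that by (simp add: bij_betw_def)
  have "?\<Psi> (vadd W x y) = vadd V (?\<Psi> x) (?\<Psi> y)" if "x \<in> vcarrier W" "y \<in> vcarrier W" for x y
  proof -
    have "\<Phi> (vadd V (?\<Psi> x) (?\<Psi> y)) = vadd W x y"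
      using iso mem right that by (simp add: linear_iso_def)
    then show ?thesis using left add mem that by metis
  qed
  moreover have "?\<Psi> (vscale W c x) = vscale V c (?\<Psi> x)" if "x \<in> vcarrier W" for c x
  proof -
    have "\<Phi> (vscale V c (?\<Psi> x)) = vscale W c x"
      using iso mem right that by (simp add: linear_iso_def)
    then show ?thesis using left scale mem that by metis
  qed
  ultimately show ?thesis
    using bij_betw_inv_into[OF bij] by (simp add: linear_iso_def)
qed

lemma dual_vs_closed:
  assumes "\<phi> \<in> vcarrier (dual_vs V)" "\<psi> \<in> vcarrier (dual_vs V)"
  shows "vadd (dual_vs V) \<phi> \<psi> \<in> vcarrier (dual_vs V)" "vscale (dual_vs V) c \<phi> \<in> vcarrier (dual_vs V)"
  using assms by (auto simp: dual_vs_def algebra_simps)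

context vector_space
begin

lemma coset_eq_iff:
  assumes "subspace U"
  shows "x +o U = y +o U \<longleftrightarrow> x - y \<in> U"
proof
  assume "x +o U = y +o U"
  moreover have "x \<in> x +o U"
    using subspace_0[OF assms] by (simp flip: set_minus_plus)
  ultimately show "x - y \<in> U" by (simp add: set_minus_plus)
next
  assume xy: "x - y \<in> U"
  have "z - x \<in> U \<longleftrightarrow> z - y \<in> U" for z
    using subspace_add[OF assms, of "z - x" "x - y"] subspace_diff[OF assms, of "z - y" "x - y"] xy
    by auto
  then show "x +o U = y +o U" by (auto simp flip: set_minus_plus)
qed

lemma coset_add:
  assumes "subspace U"
  shows "(x +o U) + (y +o U) = (x + y) +o U"
proof -
  have "U + U = U"
    using subspace_add[OF assms] subspace_0[OF assms] by (force simp: set_plus_def)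
  then show ?thesis by (simp add: set_plus_rearrange)
qed

lemma coset_scale:
  assumes "subspace U"
  shows "scale c ` (x +o U) + U = scale c x +o U"
proof (intro set_eqI iffI)
  fix z assume "z \<in> scale c ` (x +o U) + U"
  then obtain u v where "u \<in> U" "v \<in> U" "z = scale c (x + u) + v"
    by (auto simp: set_plus_def elt_set_plus_def)
  then have "z - scale c x \<in> U"
    using subspace_add[OF assms] subspace_scale[OF assms] by (simp add: scale_right_distrib)
  then show "z \<in> scale c x +o U" by (simp add: set_minus_plus)
next
  fix z assume "z \<in> scale c x +o U"
  then obtain v where "v \<in> U" "z = scale c (x + 0) + v" by (auto simp: elt_set_plus_def)
  then show "z \<in> scale c ` (x +o U) + U"
    using subspace_0[OF assms] unfolding set_plus_def elt_set_plus_def by blast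
qed

text \<open>
  A linear isomorphism onto a quotient, obtained from representatives: uniqueness modulo \<open>U\<close> gives
  injectivity, and a normal form modulo \<open>U\<close> for each element of \<open>Z\<close> gives surjectivity.
\<close>

lemma linear_iso_quotient:
  assumes U: "subspace U"
    and into: "\<And>x. x \<in> vcarrier W \<Longrightarrow> T x \<in> Z"
    and add: "\<And>x y. x \<in> vcarrier W \<Longrightarrow> y \<in> vcarrier W \<Longrightarrow> T (vadd W x y) = T x + T y"
    and scl: "\<And>c x. x \<in> vcarrier W \<Longrightarrow> T (vscale W c x) = scale c (T x)"
    and inj: "\<And>x y. x \<in> vcarrier W \<Longrightarrow> y \<in> vcarrier W \<Longrightarrow> T x - T y \<in> U \<Longrightarrow> x = y"
    and surj: "\<And>z. z \<in> Z \<Longrightarrow> \<exists>x\<in>vcarrier W. z - T x \<in> U"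
  shows "linear_iso (\<lambda>x. T x +o U) W (quotient_vs scale Z U)"
proof -
  have "bij_betw (\<lambda>x. T x +o U) (vcarrier W) ((\<lambda>z. z +o U) ` Z)"
  proof (rule bij_betw_imageI)
    show "inj_on (\<lambda>x. T x +o U) (vcarrier W)"
      by (rule inj_onI) (simp add: coset_eq_iff[OF U] inj)
    show "(\<lambda>x. T x +o U) ` vcarrier W = (\<lambda>z. z +o U) ` Z"
    proof
      show "(\<lambda>x. T x +o U) ` vcarrier W \<subseteq> (\<lambda>z. z +o U) ` Z" using into by blast
      show "(\<lambda>z. z +o U) ` Z \<subseteq> (\<lambda>x. T x +o U) ` vcarrier W"
        using surj coset_eq_iff[OF U] by blast
    qed
  qed
  then show ?thesis
    by (simp add: linear_iso_def quotient_vs_def add scl coset_add[OF U] coset_scale[OF U])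
qed

end

section \<open>Alternating forms and coboundaries\<close>

lemma vector_space_field: "vector_space ((*) :: 'k::field \<Rightarrow> 'k \<Rightarrow> 'k)"
  by unfold_locales (simp_all add: algebra_simps)

lemma vector_space_scale2: "vector_space (scale2 :: 'k::field \<Rightarrow> ('l \<Rightarrow> 'l \<Rightarrow> 'k) \<Rightarrow> _)"
  by unfold_locales (simp_all add: scale2_def fun_eq_iff algebra_simps)

context vector_space
begin

lemma linear_functional_iff:
  "Vector_Spaces.linear scale (*) f \<longleftrightarrow>
     (\<forall>x y. f (x + y) = f x + f y) \<and> (\<forall>c x. f (scale c x) = c * f x)"
  unfolding Vector_Spaces.linear_iff using vector_space_axioms vector_space_field by blast

lemma alternating_bilinear_iff:
  "alternating_bilinear scale \<omega> \<longleftrightarrow>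
     (\<forall>x y z. \<omega> x (y + z) = \<omega> x y + \<omega> x z) \<and> (\<forall>c x y. \<omega> x (scale c y) = c * \<omega> x y) \<and>
     (\<forall>x y z. \<omega> (x + y) z = \<omega> x z + \<omega> y z) \<and> (\<forall>c x y. \<omega> (scale c x) y = c * \<omega> x y) \<and>
     (\<forall>x. \<omega> x x = 0)"
  unfolding alternating_bilinear_def linear_functional_iff by blast

lemma alternating_bilinear_skew:
  assumes "alternating_bilinear scale \<omega>"
  shows "\<omega> y x = - \<omega> x y"
proof -
  have "\<omega> (x + y) (x + y) = 0" using assms unfolding alternating_bilinear_iff by blast
  moreover have "\<omega> (x + y) (x + y) = \<omega> x x + \<omega> y x + (\<omega> x y + \<omega> y y)"
    using assms unfolding alternating_bilinear_iff by metis
  moreover have "\<omega> x x = 0" "\<omega> y y = 0"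
    using assms unfolding alternating_bilinear_iff by blast+
  ultimately show ?thesis by (simp add: eq_neg_iff_add_eq_0)
qed

lemma alternating_bilinear_add:
  assumes "alternating_bilinear scale \<omega>" "alternating_bilinear scale \<omega>'"
  shows "alternating_bilinear scale (\<omega> + \<omega>')"
  using assms by (simp add: alternating_bilinear_iff algebra_simps)

lemma alternating_bilinear_scale2:
  assumes "alternating_bilinear scale \<omega>"
  shows "alternating_bilinear scale (scale2 c \<omega>)"
  using assms by (simp add: alternating_bilinear_iff scale2_def algebra_simps)

lemma ce_Z2_add:
  assumes "\<omega> \<in> ce_Z2 scale br" "\<omega>' \<in> ce_Z2 scale br"
  shows "\<omega> + \<omega>' \<in> ce_Z2 scale br"
proof -
  have "ce_d2 br (\<omega> + \<omega>') = ce_d2 br \<omega> + ce_d2 br \<omega>'"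
    by (simp add: ce_d2_def fun_eq_iff)
  then show ?thesis
    using assms by (simp add: ce_Z2_def alternating_bilinear_add fun_eq_iff)
qed

lemma ce_B2_subspace: "module.subspace scale2 (ce_B2 scale br)"
proof -
  interpret C: vector_space scale2 by (rule vector_space_scale2)
  show ?thesis
  proof (rule C.subspaceI)
    have "(0 :: _ \<Rightarrow> _ \<Rightarrow> 'a) = ce_d1 br (\<lambda>x. 0)" by (simp add: ce_d1_def fun_eq_iff)
    then show "0 \<in> ce_B2 scale br" by (auto simp: ce_B2_def linear_functional_iff)
  next
    fix \<omega> \<omega>' assume "\<omega> \<in> ce_B2 scale br" "\<omega>' \<in> ce_B2 scale br"
    then obtain \<eta> \<eta>' where "Vector_Spaces.linear scale (*) \<eta>" "\<omega> = ce_d1 br \<eta>"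
      "Vector_Spaces.linear scale (*) \<eta>'" "\<omega>' = ce_d1 br \<eta>'" by (auto simp: ce_B2_def)
    then have "Vector_Spaces.linear scale (*) (\<lambda>x. \<eta> x + \<eta>' x)"
      "\<omega> + \<omega>' = ce_d1 br (\<lambda>x. \<eta> x + \<eta>' x)"
      by (simp_all add: linear_functional_iff ce_d1_def fun_eq_iff algebra_simps)
    then show "\<omega> + \<omega>' \<in> ce_B2 scale br" by (auto simp: ce_B2_def)
  next
    fix c \<omega> assume "\<omega> \<in> ce_B2 scale br"
    then obtain \<eta> where "Vector_Spaces.linear scale (*) \<eta>" "\<omega> = ce_d1 br \<eta>"
      by (auto simp: ce_B2_def)
    then have "Vector_Spaces.linear scale (*) (\<lambda>x. c * \<eta> x)"
      "scale2 c \<omega> = ce_d1 br (\<lambda>x. c * \<eta> x)"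
      by (simp_all add: linear_functional_iff ce_d1_def scale2_def fun_eq_iff algebra_simps)
    then show "scale2 c \<omega> \<in> ce_B2 scale br" by (auto simp: ce_B2_def)
  qed
qed

end

section \<open>Basis tensors and cyclic forms\<close>

context comm_unital_algebra
begin

definition basis_tensor :: "sbasis \<Rightarrow> 'a \<Rightarrow> sbasis \<Rightarrow> 'a" where
  "basis_tensor i a = tensor scale (sb i) a"

lemma basis_tensor_apply: "basis_tensor i a j = (if j = i then a else 0)"
  by (simp add: basis_tensor_def tensor_def sb_def)

lemma basis_tensor_add: "basis_tensor i (a + b) = basis_tensor i a + basis_tensor i b"
  by (simp add: fun_eq_iff basis_tensor_apply)

lemma basis_tensor_scale: "basis_tensor i (scale c a) = current_scale scale c (basis_tensor i a)"
  by (simp add: fun_eq_iff basis_tensor_apply current_scale_def)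

lemma basis_tensor_sum: "u = basis_tensor E (u E) + basis_tensor H (u H) + basis_tensor F (u F)"
  using current_eq_sum_tensor[of u] by (simp add: basis_tensor_def sum_sbasis)

text \<open>
  The vanishing of the last bracket is why coboundaries have no \<open>ee\<close>, \<open>hh\<close> and \<open>ff\<close> components.
\<close>

lemma bracket_basis_tensor:
  "current_bracket scale (basis_tensor E a) (basis_tensor H b) = basis_tensor E (a * b)"
  "current_bracket scale (basis_tensor F a) (basis_tensor H b) = basis_tensor F (a * b)"
  "current_bracket scale (basis_tensor E a) (basis_tensor F b) = basis_tensor H (a * b)"
  "current_bracket scale (basis_tensor i a) (basis_tensor i b) = 0"
proof -
  have "tensor scale 0 c = 0" for c by (simp add: tensor_def fun_eq_iff)
  then show "current_bracket scale (basis_tensor i a) (basis_tensor i b) = 0"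
    by (cases i) (simp_all add: basis_tensor_def current_bracket_tensor S_bracket_basis)
qed (simp_all add: basis_tensor_def current_bracket_tensor S_bracket_basis)

lemma HC1_hat_add:
  assumes "\<alpha> \<in> HC1_hat scale" "\<beta> \<in> HC1_hat scale"
  shows "\<alpha> + \<beta> \<in> HC1_hat scale"
proof -
  have "(\<alpha> + \<beta>) (a * b) c + (\<alpha> + \<beta>) (c * a) b + (\<alpha> + \<beta>) (b * c) a = 0" for a b c
  proof -
    have "(\<alpha> + \<beta>) (a * b) c + (\<alpha> + \<beta>) (c * a) b + (\<alpha> + \<beta>) (b * c) a =
        (\<alpha> (a * b) c + \<alpha> (c * a) b + \<alpha> (b * c) a) + (\<beta> (a * b) c + \<beta> (c * a) b + \<beta> (b * c) a)"
      by (simp add: ac_simps)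
    also have "\<dots> = 0 + 0"
      using assms unfolding HC1_hat_def by (intro arg_cong2[where f = "(+)"]) blast+
    finally show ?thesis by simp
  qed
  then show ?thesis using assms alternating_bilinear_add unfolding HC1_hat_def by blast
qed

lemma HC1_hat_scale2:
  assumes "\<alpha> \<in> HC1_hat scale"
  shows "scale2 k \<alpha> \<in> HC1_hat scale"
proof -
  have "scale2 k \<alpha> (a * b) c + scale2 k \<alpha> (c * a) b + scale2 k \<alpha> (b * c) a = 0" for a b c
  proof -
    have "scale2 k \<alpha> (a * b) c + scale2 k \<alpha> (c * a) b + scale2 k \<alpha> (b * c) a =
        k * (\<alpha> (a * b) c + \<alpha> (c * a) b + \<alpha> (b * c) a)"
      by (simp add: scale2_def distrib_left)
    also have "\<dots> = k * 0"
      using assms unfolding HC1_hat_def by (intro arg_cong2[where f = "(*)"]) blast+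
    finally show ?thesis by simp
  qed
  then show ?thesis using assms alternating_bilinear_scale2 unfolding HC1_hat_def by blast
qed

end

section \<open>The three families of cocycles\<close>

lemma cocycle_ff_apply: "cocycle_ff \<xi> u v = \<xi> (u F * v F)"
  by (simp add: cocycle_ff_def cochain_of_def sum_sbasis)

lemma cocycle_ee_apply: "cocycle_ee \<xi> u v = \<xi> (u E * v E)"
  by (simp add: cocycle_ee_def cochain_of_def sum_sbasis)

lemma cocycle_ef_hh_apply:
  "cocycle_ef_hh \<alpha> u v = \<alpha> (u E) (v F) - \<alpha> (v E) (u F) + \<alpha> (u H) (v H)"
  by (simp add: cocycle_ef_hh_def cochain_of_def sum_sbasis)

lemmas cocycle_applies = cocycle_ff_apply cocycle_ee_apply cocycle_ef_hh_apply

locale char2_algebra = comm_unital_algebra scale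
  for scale :: "'k::field \<Rightarrow> 'a::{comm_ring, comm_monoid_mult} \<Rightarrow> 'a" +
  assumes char2: "CHAR('k) = 2"
begin

sublocale current: vector_space "current_scale scale"
  by (rule vector_space_current)

lemma add_self: "x + x = 0" for x :: 'k
proof -
  have "(1::'k) + 1 = 0" using of_nat_CHAR[where 'a = 'k] by (simp add: char2)
  then have "(1 + 1) * x = 0" by simp
  then show ?thesis by (simp add: distrib_right)
qed

lemma add_self_left: "x + (x + y) = y" for x y :: 'k
  by (simp add: add_self flip: add.assoc)

lemma uminus_eq: "- x = x" for x :: 'k
  by (simp add: add_self minus_unique)

lemma diff_eq: "x - y = x + y" for x y :: 'k
  by (metis uminus_eq diff_conv_add_uminus)

lemma add_eq_0: "x + y = 0 \<longleftrightarrow> x = y" for x y :: 'k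
  by (simp add: add_eq_0_iff2 uminus_eq)

lemmas char2_simps = add_self add_self_left uminus_eq diff_eq

lemma functional_diff:
  assumes "Vector_Spaces.linear scale (*) \<xi>"
  shows "\<xi> (a - b) = \<xi> a + \<xi> b"
proof -
  interpret \<xi>: Vector_Spaces.linear scale "(*)" \<xi> by (rule assms)
  show ?thesis by (simp add: \<xi>.diff diff_eq)
qed

text \<open>
  For \<open>ff\<close>, the differential on \<open>f \<otimes> a, f \<otimes> b, h \<otimes> c\<close> is a sum of two terms \<open>\<xi>(abc)\<close>, which cancel
  in characteristic 2; on all other triples of basis tensors each term vanishes. The form is
  alternating because \<open>\<xi>\<close> kills the squares. The case of \<open>ee\<close> is symmetric.
\<close>

lemma cocycle_ff_ee_in_Z2:
  assumes \<xi>: "Vector_Spaces.linear scale (*) \<xi>" and squares: "\<forall>a\<in>squares_span scale. \<xi> a = 0"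
  shows "cocycle_ff \<xi> \<in> ce_Z2 (current_scale scale) (current_bracket scale)"
    and "cocycle_ee \<xi> \<in> ce_Z2 (current_scale scale) (current_bracket scale)"
proof -
  have sq: "\<xi> (a * a) = 0" for a
  proof -
    have "a ^ 2 \<in> squares_span scale" unfolding squares_span_def by (intro span_base rangeI)
    then show ?thesis using squares by (auto simp: power2_eq_square)
  qed
  note lin = \<xi>[unfolded linear_functional_iff]
  show "cocycle_ff \<xi> \<in> ce_Z2 (current_scale scale) (current_bracket scale)"
    by (simp add: ce_Z2_def ce_d2_def current.alternating_bilinear_iff cocycle_ff_apply lin sq
        current_scale_def current_bracket_eqs scale_mult_left scale_mult_right fun_eq_iff
        functional_diff[OF \<xi>] distrib_left distrib_right left_diff_distrib
        right_diff_distrib char2_simps ac_simps)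
  show "cocycle_ee \<xi> \<in> ce_Z2 (current_scale scale) (current_bracket scale)"
    by (simp add: ce_Z2_def ce_d2_def current.alternating_bilinear_iff cocycle_ee_apply lin sq
        current_scale_def current_bracket_eqs scale_mult_left scale_mult_right fun_eq_iff
        functional_diff[OF \<xi>] distrib_left distrib_right left_diff_distrib
        right_diff_distrib char2_simps ac_simps)
qed

lemma alternating_bilinear_sym:
  assumes "alternating_bilinear scale \<alpha>"
  shows "\<alpha> a b = \<alpha> b a"
  using alternating_bilinear_skew[OF assms, of a b] by (simp add: uminus_eq)

text \<open>
  The differential is nonzero at most on triples of type \<open>e, f, h\<close>, where it is the cyclic sum of \<open>\<alpha>\<close>.
  On general arguments \<open>u, v, w\<close> it is the sum of these cyclic sums over the six ways to distribute
  the three roles among \<open>u, v, w\<close>.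
\<close>

lemma cocycle_ef_hh_in_Z2:
  assumes "\<alpha> \<in> HC1_hat scale"
  shows "cocycle_ef_hh \<alpha> \<in> ce_Z2 (current_scale scale) (current_bracket scale)"
proof -
  have alt: "alternating_bilinear scale \<alpha>" using assms by (simp add: HC1_hat_def)
  note bil = alt[unfolded alternating_bilinear_iff]
  note sym = alternating_bilinear_sym[OF alt]
  have diff: "\<alpha> (a - b) c = \<alpha> a c + \<alpha> b c" for a b c
    using alt functional_diff[of "\<lambda>x. \<alpha> x c"] by (simp add: alternating_bilinear_def)
  have cyc: "\<alpha> (a * b) c = \<alpha> (c * a) b + \<alpha> (b * c) a" for a b c
  proof -
    have "\<alpha> (a * b) c + \<alpha> (c * a) b + \<alpha> (b * c) a = 0"
      using assms unfolding HC1_hat_def by blast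
    then show ?thesis unfolding add.assoc add_eq_0 .
  qed
  have "alternating_bilinear (current_scale scale) (cocycle_ef_hh \<alpha>)"
    by (simp add: current.alternating_bilinear_iff cocycle_ef_hh_apply bil current_scale_def
        algebra_simps)
  moreover have "ce_d2 (current_bracket scale) (cocycle_ef_hh \<alpha>) u v w = 0" for u v w
    \<comment> \<open>Symmetry moves every product to the first argument of \<open>\<alpha>\<close>; then the cyclic identity eliminates
      the products of an \<open>E\<close> with an \<open>F\<close> coordinate, and the remaining terms cancel in pairs.\<close>
    unfolding ce_d2_def cocycle_ef_hh_apply current_bracket_eqs diff
      sym[of "u E"] sym[of "v E"] sym[of "w E"] 
    using cyc[of "u E" "v F" "w H"] cyc[of "u E" "w F" "v H"] cyc[of "v E" "u F" "w H"]
      cyc[of "v E" "w F" "u H"] cyc[of "w E" "u F" "v H"] cyc[of "w E" "v F" "u H"]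
    by (simp add: diff char2_simps ac_simps)
  ultimately show ?thesis by (simp add: ce_Z2_def fun_eq_iff)
qed

section \<open>The normal form of a cocycle\<close>

text \<open>
  The components with a repeated index are kept, as \<open>\<xi>\<close>, \<open>\<zeta>\<close> and \<open>\<alpha>\<close>; the mixed components provide
  the coboundary to be subtracted.
\<close>

lemma cocycle_normal_form:
  assumes "\<omega> \<in> ce_Z2 (current_scale scale) (current_bracket scale)"
  obtains \<xi> \<zeta> \<alpha> where
    "Vector_Spaces.linear scale (*) \<xi>" "\<forall>a\<in>squares_span scale. \<xi> a = 0"
    "Vector_Spaces.linear scale (*) \<zeta>" "\<forall>a\<in>squares_span scale. \<zeta> a = 0"
    "\<alpha> \<in> HC1_hat scale"
    "\<omega> - (cocycle_ff \<xi> + cocycle_ee \<zeta> + cocycle_ef_hh \<alpha>) \<in>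
       ce_B2 (current_scale scale) (current_bracket scale)"
proof -
  have alt: "alternating_bilinear (current_scale scale) \<omega>"
    and closed: "ce_d2 (current_bracket scale) \<omega> = (\<lambda>x y z. 0)"
    using assms by (auto simp: ce_Z2_def)
  note bil = alt[unfolded current.alternating_bilinear_iff]
  have sym: "\<omega> y x = \<omega> x y" for x y
    using current.alternating_bilinear_skew[OF alt, of y x] by (simp add: uminus_eq)
  have zero: "\<omega> 0 x = 0" for x
  proof -
    interpret l: Vector_Spaces.linear "current_scale scale" "(*)" "\<lambda>y. \<omega> y x"
      using alt by (simp add: alternating_bilinear_def)
    show ?thesis by (rule l.zero)
  qed
  define comp where "comp i j a b = \<omega> (basis_tensor i a) (basis_tensor j b)" for i j a b
  have comp_bil: "comp i j (a + b) c = comp i j a c + comp i j b c"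
    "comp i j a (b + c) = comp i j a b + comp i j a c"
    "comp i j (scale k a) c = k * comp i j a c"
    "comp i j a (scale k c) = k * comp i j a c" for i j a b c k
    by (simp_all add: comp_def basis_tensor_add basis_tensor_scale bil)
  have comp_alt: "comp i i a a = 0" for i a by (simp add: comp_def bil)
  have comp_sym: "comp i j a b = comp j i b a" for i j a b by (simp add: comp_def sym)
  have cocycle: "\<omega> (current_bracket scale x y) z + \<omega> (current_bracket scale x z) y
      + \<omega> (current_bracket scale y z) x = 0" for x y z
    using fun_cong[OF fun_cong[OF fun_cong[OF closed, of x], of y], of z]
    by (simp add: ce_d2_def char2_simps)
  have mixed: "comp i H a b = comp i H (a * b) 1" if "i \<noteq> H" for i a b
  proof -
    have "comp i H (a * 1) b + comp i H (a * b) 1 = 0"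
      using cocycle[of "basis_tensor i a" "basis_tensor H 1" "basis_tensor H b"] that
      by (cases i) (simp_all add: bracket_basis_tensor comp_def zero)
    then show ?thesis using add_eq_0 by simp
  qed
  have diag: "comp i i a b = comp i i (a * b) 1" if "i \<noteq> H" for i a b
  proof -
    have "comp i i (a * b) 1 + comp i i (1 * b) a = 0"
      using cocycle[of "basis_tensor i a" "basis_tensor i 1" "basis_tensor H b"] that
      by (cases i) (simp_all add: bracket_basis_tensor comp_def zero)
    then show ?thesis using add_eq_0 comp_sym by simp
  qed
  have ehf: "comp H H (a * b) c + comp E F (a * c) b + comp E F a (b * c) = 0" for a b c
    using cocycle[of "basis_tensor E a" "basis_tensor F b" "basis_tensor H c"]
    by (simp add: bracket_basis_tensor comp_def sym)
  have ef: "comp E F a b = comp H H a b + comp E F 1 (a * b)" for a b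
  proof -
    have "comp E F a b + (comp H H a b + comp E F 1 (a * b)) = 0"
      using ehf[of 1 b a] comp_sym[of H H a b] by (simp add: ac_simps)
    then show ?thesis by (simp add: add_eq_0)
  qed
  define \<xi> where "\<xi> i a = comp i i a 1" for i a
  have \<xi>_lin: "Vector_Spaces.linear scale (*) (\<xi> i)" for i
    by (simp add: linear_functional_iff \<xi>_def comp_bil)
  have \<xi>_squares: "\<forall>a\<in>squares_span scale. \<xi> i a = 0" if "i \<noteq> H" for i
  proof
    interpret \<xi>: Vector_Spaces.linear scale "(*)" "\<xi> i" by (rule \<xi>_lin)
    have "subspace {a. \<xi> i a = 0}" by (rule subspaceI) (simp_all add: \<xi>.add \<xi>.scale \<xi>.zero)
    moreover have "range (\<lambda>a. a ^ 2) \<subseteq> {a. \<xi> i a = 0}"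
      using diag[OF that] comp_alt[of i] by (auto simp: \<xi>_def power2_eq_square)
    ultimately show "\<xi> i a = 0" if "a \<in> squares_span scale" for a
      using that span_minimal unfolding squares_span_def by blast
  qed
  have \<alpha>: "comp H H \<in> HC1_hat scale"
  proof -
    have "comp H H (a * b) c + comp H H (c * a) b + comp H H (b * c) a = 0" for a b c
      using ehf[of a b c] comp_sym[of H H a "b * c"] ef[of "a * c" b] ef[of a "b * c"]
      by (simp add: ac_simps char2_simps)
    then show ?thesis
      by (simp add: HC1_hat_def alternating_bilinear_iff comp_bil comp_alt)
  qed
  \<comment> \<open>By \<open>mixed\<close> and \<open>ef\<close>, these are the functionals through which the mixed components depend on the
    product of their arguments.\<close>
  define \<eta> where "\<eta> u = comp E H (u E) 1 + comp F H (u F) 1 + comp E F 1 (u H)" for u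
  have \<eta>: "Vector_Spaces.linear (current_scale scale) (*) \<eta>"
    by (simp add: current.linear_functional_iff \<eta>_def comp_bil current_scale_def algebra_simps)
  have expand: "\<omega> u v = comp E E (u E) (v E) + comp E H (u E) (v H) + comp E F (u E) (v F)
      + comp E H (v E) (u H) + comp H H (u H) (v H) + comp F H (v F) (u H)
      + comp E F (v E) (u F) + comp F H (u F) (v H) + comp F F (u F) (v F)" for u v
  proof -
    have "\<omega> u v = \<omega> (basis_tensor E (u E) + basis_tensor H (u H) + basis_tensor F (u F))
        (basis_tensor E (v E) + basis_tensor H (v H) + basis_tensor F (v F))"
      by (rule arg_cong2[where f = \<omega>]) (rule basis_tensor_sum)+
    then show ?thesis
      using comp_sym[of H E "u H" "v E"] comp_sym[of H F "u H" "v F"] comp_sym[of F E "u F" "v E"]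
      by (simp add: bil comp_def ac_simps)
  qed
  have diff: "comp i j (a - b) c = comp i j a c + comp i j b c"
    "comp i j c (a - b) = comp i j c a + comp i j c b" for i j a b c
    using functional_diff[of "\<lambda>x. comp i j x c"] functional_diff[of "\<lambda>x. comp i j c x"]
    by (simp_all add: linear_functional_iff comp_bil)
  have "\<omega> - (cocycle_ff (\<xi> F) + cocycle_ee (\<xi> E) + cocycle_ef_hh (comp H H))
      = ce_d1 (current_bracket scale) \<eta>"
  proof (intro ext)
    fix u v
    show "(\<omega> - (cocycle_ff (\<xi> F) + cocycle_ee (\<xi> E) + cocycle_ef_hh (comp H H))) u v
      = ce_d1 (current_bracket scale) \<eta> u v"
      using diag[of F "u F" "v F"] diag[of E "u E" "v E"]
        mixed[of E "u E" "v H"] mixed[of E "v E" "u H"] mixed[of F "u F" "v H"]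
        mixed[of F "v F" "u H"] ef[of "u E" "v F"] ef[of "v E" "u F"]
      by (simp add: ce_d1_def \<eta>_def expand cocycle_applies \<xi>_def current_bracket_eqs diff
          char2_simps ac_simps)
  qed
  then have "\<omega> - (cocycle_ff (\<xi> F) + cocycle_ee (\<xi> E) + cocycle_ef_hh (comp H H)) \<in>
      ce_B2 (current_scale scale) (current_bracket scale)"
    using \<eta> by (auto simp: ce_B2_def)
  then show ?thesis 
    using that[of "\<xi> F" "\<xi> E" "comp H H"] \<xi>_lin \<xi>_squares \<alpha> by simp
qed

text \<open>
  A coboundary vanishes on pairs of basis tensors \<open>i \<otimes> a\<close>, \<open>i \<otimes> b\<close> with the same \<open>i\<close>, so both normal
  forms agree there. For \<open>ff\<close> and \<open>ee\<close> the choice \<open>b = 1\<close> recovers the functional.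
\<close>

lemma normal_form_unique:
  assumes "cocycle_ff \<xi> + cocycle_ee \<zeta> + cocycle_ef_hh \<alpha>
      - (cocycle_ff \<xi>' + cocycle_ee \<zeta>' + cocycle_ef_hh \<alpha>')
    \<in> ce_B2 (current_scale scale) (current_bracket scale)"
    and \<xi>: "\<xi> 0 = 0" "\<xi>' 0 = 0" "\<zeta> 0 = 0" "\<zeta>' 0 = 0"
    and \<alpha>: "\<alpha> \<in> HC1_hat scale" "\<alpha>' \<in> HC1_hat scale"
  shows "\<xi> = \<xi>' \<and> \<zeta> = \<zeta>' \<and> \<alpha> = \<alpha>'"
proof -
  let ?c = "cocycle_ff \<xi> + cocycle_ee \<zeta> + cocycle_ef_hh \<alpha>"
  let ?c' = "cocycle_ff \<xi>' + cocycle_ee \<zeta>' + cocycle_ef_hh \<alpha>'"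
  obtain \<eta> where \<eta>: "Vector_Spaces.linear (current_scale scale) (*) \<eta>"
    "?c - ?c' = ce_d1 (current_bracket scale) \<eta>"
    using assms(1) by (auto simp: ce_B2_def)
  interpret \<eta>: Vector_Spaces.linear "current_scale scale" "(*)" \<eta> by (rule \<eta>(1))
  have eq: "?c (basis_tensor i a) (basis_tensor i b) = ?c' (basis_tensor i a) (basis_tensor i b)" for i a b
    using fun_cong[OF fun_cong[OF \<eta>(2), of "basis_tensor i a"], of "basis_tensor i b"]
    by (simp add: ce_d1_def bracket_basis_tensor \<eta>.zero)
  have \<alpha>0: "\<beta> 0 b = 0" "\<beta> b 0 = 0" if "\<beta> \<in> HC1_hat scale" for \<beta> b
  proof -
    interpret l: Vector_Spaces.linear scale "(*)" "\<lambda>x. \<beta> x b"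
      using that by (simp add: HC1_hat_def alternating_bilinear_def)
    interpret r: Vector_Spaces.linear scale "(*)" "\<lambda>x. \<beta> b x"
      using that by (simp add: HC1_hat_def alternating_bilinear_def)
    show "\<beta> 0 b = 0" "\<beta> b 0 = 0" by (rule l.zero r.zero)+
  qed
  note s = cocycle_applies basis_tensor_apply \<xi> \<alpha>0[OF \<alpha>(1)] \<alpha>0[OF \<alpha>(2)]
  have "\<xi> a = \<xi>' a" for a using eq[of F a 1] by (simp add: s)
  moreover have "\<zeta> a = \<zeta>' a" for a using eq[of E a 1] by (simp add: s)
  moreover have "\<alpha> a b = \<alpha>' a b" for a b using eq[of H a b] by (simp add: s)
  ultimately show ?thesis by (simp add: fun_eq_iff)
qed

section \<open>The second cohomology\<close>

lemma second_cohomology: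
  defines "A2 \<equiv> squares_span scale"
  defines "D \<equiv> dual_vs (quotient_vs scale UNIV A2)"
  defines "W \<equiv> D \<oplus> D \<oplus> subspace_vs scale2 (HC1_hat scale)"
  defines "T \<equiv> \<lambda>(\<phi>, \<psi>, \<alpha>).
     cocycle_ff (\<lambda>a. \<phi> (a +o A2)) + cocycle_ee (\<lambda>a. \<psi> (a +o A2)) + cocycle_ef_hh \<alpha>"
  shows "linear_iso (\<lambda>x. cohomology_class (current_scale scale) (current_bracket scale) (T x)) W
           (ce_H2 (current_scale scale) (current_bracket scale))"
    and "ce_H2 (current_scale scale) (current_bracket scale) \<simeq> W"
proof -
  interpret C: vector_space "scale2 :: 'k \<Rightarrow> ((sbasis \<Rightarrow> 'a) \<Rightarrow> (sbasis \<Rightarrow> 'a) \<Rightarrow> 'k) \<Rightarrow> _"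
    by (rule vector_space_scale2)
  let ?P = "\<lambda>\<phi> a. \<phi> (a +o A2)"
  let ?X = "{\<xi>. Vector_Spaces.linear scale (*) \<xi> \<and> (\<forall>a\<in>A2. \<xi> a = 0)}"
  let ?Z = "ce_Z2 (current_scale scale) (current_bracket scale)"
  let ?B = "ce_B2 (current_scale scale) (current_bracket scale)"
  have pullback: "bij_betw ?P (vcarrier D) ?X"
    unfolding D_def A2_def by (rule dual_quotient_pullback)
  have P_mem: "?P \<phi> \<in> ?X" if "\<phi> \<in> vcarrier D" for \<phi>
    using bij_betw_apply[OF pullback that] .
  have P_0: "\<phi> (0 +o A2) = 0" if "\<phi> \<in> vcarrier D" for \<phi>
  proof -
    have "0 \<in> A2" unfolding A2_def squares_span_def by (rule span_zero)
    moreover have "\<forall>a\<in>A2. ?P \<phi> a = 0" using P_mem[OF that] by simp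
    ultimately show ?thesis by blast
  qed
  have P_inj: "\<phi> = \<phi>'" if "\<phi> \<in> vcarrier D" "\<phi>' \<in> vcarrier D" "?P \<phi> = ?P \<phi>'" for \<phi> \<phi>'
    using inj_onD[OF bij_betw_imp_inj_on[OF pullback] that(3,1,2)] .
  have P_surj: "\<exists>\<phi>\<in>vcarrier D. ?P \<phi> = \<xi>" if "\<xi> \<in> ?X" for \<xi>
  proof -
    have "\<xi> \<in> ?P ` vcarrier D" using that unfolding bij_betw_imp_surj_on[OF pullback] .
    then show ?thesis by (elim imageE) (rule bexI, rule sym)
  qed
  have W: "vcarrier W = vcarrier D \<times> vcarrier D \<times> HC1_hat scale"
    by (simp add: W_def direct_sum_def subspace_vs_def)
  have W_add: "vadd W (\<phi>, \<psi>, \<alpha>) (\<phi>', \<psi>', \<alpha>') = (vadd D \<phi> \<phi>', vadd D \<psi> \<psi>', \<alpha> + \<alpha>')"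
    and W_scale: "vscale W c (\<phi>, \<psi>, \<alpha>) = (vscale D c \<phi>, vscale D c \<psi>, scale2 c \<alpha>)"
    for \<phi> \<psi> \<alpha> \<phi>' \<psi>' \<alpha>' c by (simp_all add: W_def direct_sum_def subspace_vs_def)
  have D_add: "vadd D \<phi> \<psi> x = \<phi> x + \<psi> x" and D_scale: "vscale D c \<phi> x = c * \<phi> x" for \<phi> \<psi> c x
    by (simp_all add: D_def dual_vs_def)
  have "linear_iso (\<lambda>x. T x +o ?B) W (quotient_vs scale2 ?Z ?B)"
  proof (rule C.linear_iso_quotient)
    show "C.subspace ?B" by (rule current.ce_B2_subspace)
  next
    fix x assume "x \<in> vcarrier W"
    then obtain \<phi> \<psi> \<alpha> where x: "x = (\<phi>, \<psi>, \<alpha>)" "\<phi> \<in> vcarrier D" "\<psi> \<in> vcarrier D"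
      "\<alpha> \<in> HC1_hat scale" by (auto simp: W)
    have "cocycle_ff (?P \<phi>) \<in> ?Z" "cocycle_ee (?P \<psi>) \<in> ?Z"
      using P_mem[OF x(2)] P_mem[OF x(3)] by (auto intro!: cocycle_ff_ee_in_Z2 simp: A2_def)
    then show "T x \<in> ?Z"
      using x(4) by (simp add: x(1) T_def current.ce_Z2_add cocycle_ef_hh_in_Z2)
  next
    fix x y assume "x \<in> vcarrier W" "y \<in> vcarrier W"
    show "T (vadd W x y) = T x + T y"
      by (cases x; cases y) (simp add: W_add D_add T_def cocycle_applies fun_eq_iff algebra_simps)
  next
    fix c x assume "x \<in> vcarrier W"
    show "T (vscale W c x) = scale2 c (T x)"
      by (cases x) (simp add: W_scale D_scale T_def cocycle_applies scale2_def fun_eq_iff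
          algebra_simps)
  next
    fix x y assume xy: "x \<in> vcarrier W" "y \<in> vcarrier W" "T x - T y \<in> ?B"
    from xy(1,2) obtain \<phi> \<psi> \<alpha> \<phi>' \<psi>' \<alpha>' where
      x: "x = (\<phi>, \<psi>, \<alpha>)" "\<phi> \<in> vcarrier D" "\<psi> \<in> vcarrier D" "\<alpha> \<in> HC1_hat scale" and
      y: "y = (\<phi>', \<psi>', \<alpha>')" "\<phi>' \<in> vcarrier D" "\<psi>' \<in> vcarrier D" "\<alpha>' \<in> HC1_hat scale"
      by (auto simp: W)
    have "?P \<phi> = ?P \<phi>' \<and> ?P \<psi> = ?P \<psi>' \<and> \<alpha> = \<alpha>'"
      by (rule normal_form_unique) (use xy(3) x y P_0 in \<open>auto simp: T_def\<close>)
    then show "x = y" using x y P_inj by blast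
  next
    fix \<omega> assume "\<omega> \<in> ?Z"
    then obtain \<xi> \<zeta> \<alpha> where "\<xi> \<in> ?X" "\<zeta> \<in> ?X" and \<alpha>: "\<alpha> \<in> HC1_hat scale"
      and \<omega>: "\<omega> - (cocycle_ff \<xi> + cocycle_ee \<zeta> + cocycle_ef_hh \<alpha>) \<in> ?B"
      by (rule cocycle_normal_form) (auto simp: A2_def)
    then obtain \<phi> \<psi> where "\<phi> \<in> vcarrier D" "?P \<phi> = \<xi>" "\<psi> \<in> vcarrier D" "?P \<psi> = \<zeta>"
      using P_surj by meson
    then have "(\<phi>, \<psi>, \<alpha>) \<in> vcarrier W" "\<omega> - T (\<phi>, \<psi>, \<alpha>) \<in> ?B"
      using \<alpha> \<omega> by (auto simp: W T_def)
    then show "\<exists>x\<in>vcarrier W. \<omega> - T x \<in> ?B" by blast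
  qed
  then show iso: "linear_iso (\<lambda>x. cohomology_class (current_scale scale) (current_bracket scale) (T x))
      W (ce_H2 (current_scale scale) (current_bracket scale))"
    by (simp add: cohomology_class_def ce_H2_def)
  have D_closed: "vadd D \<phi> \<psi> \<in> vcarrier D" "vscale D c \<phi> \<in> vcarrier D"
    if "\<phi> \<in> vcarrier D" "\<psi> \<in> vcarrier D" for \<phi> \<psi> c
    using that unfolding D_def by (simp_all add: dual_vs_closed)
  show "ce_H2 (current_scale scale) (current_bracket scale) \<simeq> W"
    unfolding isomorphic_def
    by (rule exI, rule linear_iso_inverse[OF iso])
      (auto simp: W W_add W_scale HC1_hat_add HC1_hat_scale2 D_closed)
qed

end

theorem proposition2p1:
  fixes scale :: "'k::field \<Rightarrow> 'a::{comm_ring, comm_monoid_mult} \<Rightarrow> 'a"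
  assumes "CHAR('k) = 2"
    and "comm_unital_algebra scale"
  shows
    "let s = current_scale scale;
         br = current_bracket scale;
         A2 = squares_span scale;
         D = dual_vs (quotient_vs scale UNIV A2);
         HC = subspace_vs scale2 (HC1_hat scale)
     in ce_H2 s br \<simeq> D \<oplus> D \<oplus> HC \<and>
        (\<forall>\<xi>. Vector_Spaces.linear scale (*) \<xi> \<and> (\<forall>a\<in>A2. \<xi> a = 0) \<longrightarrow>
              cocycle_ff \<xi> \<in> ce_Z2 s br \<and> cocycle_ee \<xi> \<in> ce_Z2 s br) \<and>
        (\<forall>\<alpha>\<in>HC1_hat scale. cocycle_ef_hh \<alpha> \<in> ce_Z2 s br) \<and>
        linear_iso
          (\<lambda>(\<phi>, \<psi>, \<alpha>). cohomology_class s br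
             (cocycle_ff (\<lambda>a. \<phi> (a +o A2)) + cocycle_ee (\<lambda>a. \<psi> (a +o A2)) + cocycle_ef_hh \<alpha>))
          (D \<oplus> D \<oplus> HC) (ce_H2 s br)"
proof -
  interpret char2_algebra scale
    using assms by (simp add: char2_algebra_def char2_algebra_axioms_def)
  show ?thesis
    unfolding Let_def
    using second_cohomology cocycle_ff_ee_in_Z2 cocycle_ef_hh_in_Z2
    by (simp add: case_prod_unfold)
qed

end
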